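(* Let $S$ and $R$ be rings and let $f:S\rightarrow R$ be a (not necessarily unitary) ring homomorphism with $f[S]\subseteq Z(R)$. Then the following conditions are equivalent: 1. $f$ satisfies the layer $1$, layer $2$ and layer $3$ properties. 2. $f$ satisfies LO, INC, GD, GU and SGB. 3. For every chain $\mathcal D\subseteq \mathrm{Spec}(S)$ and for every maximal $\mathcal D$-chain $\mathcal C\subseteq \mathrm{Spec}(R)$, $\mathcal C$ is a perfect maximal cover of $\mathcal D$. 4. For every chain $\mathcal D\subseteq \mathrm{Spec}(S)$ and for every maximal $\mathcal D$-chain $\mathcal C\subseteq \mathrm{Spec}(R)$, $|\mathcal C|=|\mathcal D|$.
   Context: Rings are nontrivial, associative, with identity, not necessarily commutative; homomorphisms need not send $1$ to $1$. $Z(R)$ is the center of $R$. $\mathrm{Spec}$ denotes the set of prime (two-sided, proper) ideals: $P$ is prime if $aRb\subseteq P$ implies $a\in P$ or $b\in P$. $\subset$ means proper inclusion. All chains are with respect to containment. An ideal $Q$ of $R$ lies over an ideal $P$ of $S$ if $f^{-1}[Q]=P$. (For $Q\in\mathrm{Spec}(R)$, $f^{-1}[Q]$ is either a prime ideal of $S$ or equal to $S$.) LO: for all $P\in\mathrm{Spec}(S)$ there is $Q\in\mathrm{Spec}(R)$ lying over $P$. INC: whenever $Q_1\subset Q_2$ in $\mathrm{Spec}(R)$ and $f^{-1}[Q_2]\neq S$, we have $f^{-1}[Q_1]\subset f^{-1}[Q_2]$. GD: for any $P_1\subset P_2$ in $\mathrm{Spec}(S)$ and every $Q_2\in\mathrm{Spec}(R)$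 lying over $P_2$, there is $Q_1\subset Q_2$ in $\mathrm{Spec}(R)$ lying over $P_1$. GU: for any $P_1\subset P_2$ in $\mathrm{Spec}(S)$ and every $Q_1\in\mathrm{Spec}(R)$ lying over $P_1$, there is $Q_2\in\mathrm{Spec}(R)$ with $Q_1\subset Q_2$ lying over $P_2$. SGB: for any $P_1\subset P_2\subset P_3$ in $\mathrm{Spec}(S)$ and every $Q_1\subset Q_3$ in $\mathrm{Spec}(R)$ with $Q_1$ lying over $P_1$ and $Q_3$ lying over $P_3$, there is $Q_2\in\mathrm{Spec}(R)$ with $Q_1\subset Q_2\subset Q_3$ lying over $P_2$. Let $\mathcal D\subseteq\mathrm{Spec}(S)$ be a chain. A $\mathcal D$-chain is a chain $\mathcal C\subseteq\mathrm{Spec}(R)$ with $f^{-1}[Q]\in\mathcal D$ for every $Q\in\mathcal C$. A maximal $\mathcal D$-chain is a $\mathcal D$-chain that is maximal, with respect to containment, among $\mathcal D$-chains. A $\mathcal D$-chain $\mathcal C$ is a cover of $\mathcal D$ if the map $Q\mapsto f^{-1}[Q]$ from $\mathcal C$ to $\mathcal D$ is surjective, and a perfect cover if this map is bijective; a maximal cover is a cover of $\mathcal D$ which is maximal with respect to containment; a perfect maximal cover is a maximal cover that is a perfect cover. For $n\in\mathbb N$, $f$ satisfies the layer $n$ property if for every chain $\mathcal D\subseteq\mathrm{Spec}(S)$ of cardinality $n$, every maximal $\mathcal D$-chain is of cardinality $n$. *)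

theory Defs
  imports "HOL-Algebra.Ideal" "HOL-Library.Equipollence"
begin

text \<open>
  Rings are HOL-Algebra rings: associative, with identity, not necessarily commutative.
  Nontriviality is not part of \<open>ring\<close>, so it is added here.
\<close>

definition nontrivial_ring :: "('a, 'm) ring_scheme \<Rightarrow> bool" where
  "nontrivial_ring R \<longleftrightarrow> ring R \<and> \<one>\<^bsub>R\<^esub> \<noteq> \<zero>\<^bsub>R\<^esub>"

definition ring_center :: "('a, 'm) ring_scheme \<Rightarrow> 'a set" where
  "ring_center R = {z \<in> carrier R. \<forall>x \<in> carrier R. z \<otimes>\<^bsub>R\<^esub> x = x \<otimes>\<^bsub>R\<^esub> z}"

text \<open>
  The library's \<open>ring_hom\<close> demands that the identity be preserved; here it need not be.
\<close>

definition nonunital_ring_hom ::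
    "('a, 'm) ring_scheme \<Rightarrow> ('b, 'n) ring_scheme \<Rightarrow> ('a \<Rightarrow> 'b) set" where
  "nonunital_ring_hom S R = hom S R \<inter> hom (add_monoid S) (add_monoid R)"

text \<open>
  Prime ideals of a possibly noncommutative ring; the library's \<open>primeideal\<close> is elementwise
  and restricted to commutative rings.
\<close>

definition prime_ideal :: "('a, 'm) ring_scheme \<Rightarrow> 'a set \<Rightarrow> bool" where
  "prime_ideal R P \<longleftrightarrow> ideal P R \<and> P \<noteq> carrier R \<and>
     (\<forall>a \<in> carrier R. \<forall>b \<in> carrier R.
        (\<forall>r \<in> carrier R. a \<otimes>\<^bsub>R\<^esub> r \<otimes>\<^bsub>R\<^esub> b \<in> P) \<longrightarrow> a \<in> P \<or> b \<in> P)"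

definition Spec :: "('a, 'm) ring_scheme \<Rightarrow> 'a set set" where
  "Spec R = {P. prime_ideal R P}"

definition contraction :: "('a, 'm) ring_scheme \<Rightarrow> ('a \<Rightarrow> 'b) \<Rightarrow> 'b set \<Rightarrow> 'a set" where
  "contraction S f Q = {x \<in> carrier S. f x \<in> Q}"

definition lies_over ::
    "('a, 'm) ring_scheme \<Rightarrow> ('a \<Rightarrow> 'b) \<Rightarrow> 'b set \<Rightarrow> 'a set \<Rightarrow> bool" where
  "lies_over S f Q P \<longleftrightarrow> contraction S f Q = P"

definition LO ::
    "('a, 'm) ring_scheme \<Rightarrow> ('b, 'n) ring_scheme \<Rightarrow> ('a \<Rightarrow> 'b) \<Rightarrow> bool" where
  "LO S R f \<longleftrightarrow> (\<forall>P \<in> Spec S. \<exists>Q \<in> Spec R. lies_over S f Q P)"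

definition INC ::
    "('a, 'm) ring_scheme \<Rightarrow> ('b, 'n) ring_scheme \<Rightarrow> ('a \<Rightarrow> 'b) \<Rightarrow> bool" where
  "INC S R f \<longleftrightarrow>
     (\<forall>Q1 \<in> Spec R. \<forall>Q2 \<in> Spec R. Q1 \<subset> Q2 \<and> contraction S f Q2 \<noteq> carrier S \<longrightarrow>
        contraction S f Q1 \<subset> contraction S f Q2)"

definition GD ::
    "('a, 'm) ring_scheme \<Rightarrow> ('b, 'n) ring_scheme \<Rightarrow> ('a \<Rightarrow> 'b) \<Rightarrow> bool" where
  "GD S R f \<longleftrightarrow>
     (\<forall>P1 \<in> Spec S. \<forall>P2 \<in> Spec S. P1 \<subset> P2 \<longrightarrow>
        (\<forall>Q2 \<in> Spec R. lies_over S f Q2 P2 \<longrightarrow>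
           (\<exists>Q1 \<in> Spec R. Q1 \<subset> Q2 \<and> lies_over S f Q1 P1)))"

definition GU ::
    "('a, 'm) ring_scheme \<Rightarrow> ('b, 'n) ring_scheme \<Rightarrow> ('a \<Rightarrow> 'b) \<Rightarrow> bool" where
  "GU S R f \<longleftrightarrow>
     (\<forall>P1 \<in> Spec S. \<forall>P2 \<in> Spec S. P1 \<subset> P2 \<longrightarrow>
        (\<forall>Q1 \<in> Spec R. lies_over S f Q1 P1 \<longrightarrow>
           (\<exists>Q2 \<in> Spec R. Q1 \<subset> Q2 \<and> lies_over S f Q2 P2)))"

definition SGB ::
    "('a, 'm) ring_scheme \<Rightarrow> ('b, 'n) ring_scheme \<Rightarrow> ('a \<Rightarrow> 'b) \<Rightarrow> bool" where
  "SGB S R f \<longleftrightarrow>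
     (\<forall>P1 \<in> Spec S. \<forall>P2 \<in> Spec S. \<forall>P3 \<in> Spec S. P1 \<subset> P2 \<and> P2 \<subset> P3 \<longrightarrow>
        (\<forall>Q1 \<in> Spec R. \<forall>Q3 \<in> Spec R.
           Q1 \<subset> Q3 \<and> lies_over S f Q1 P1 \<and> lies_over S f Q3 P3 \<longrightarrow>
           (\<exists>Q2 \<in> Spec R. Q1 \<subset> Q2 \<and> Q2 \<subset> Q3 \<and> lies_over S f Q2 P2)))"

text \<open>
  \<open>subset.chain A C\<close> says that \<open>C \<subseteq> A\<close> is totally ordered by inclusion; the empty chain is allowed.
  In \<open>D_chain\<close> and the predicates built on it, \<open>D\<close> is meant to be a chain in \<open>Spec S\<close>.
\<close>

definition D_chain ::
    "('a, 'm) ring_scheme \<Rightarrow> ('b, 'n) ring_scheme \<Rightarrow> ('a \<Rightarrow> 'b) \<Rightarrow> 'a set set \<Rightarrow> 'b set set \<Rightarrow> bool" where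
  "D_chain S R f D C \<longleftrightarrow> subset.chain (Spec R) C \<and> (\<forall>Q \<in> C. contraction S f Q \<in> D)"

definition maximal_D_chain ::
    "('a, 'm) ring_scheme \<Rightarrow> ('b, 'n) ring_scheme \<Rightarrow> ('a \<Rightarrow> 'b) \<Rightarrow> 'a set set \<Rightarrow> 'b set set \<Rightarrow> bool" where
  "maximal_D_chain S R f D C \<longleftrightarrow>
     D_chain S R f D C \<and> (\<forall>C'. D_chain S R f D C' \<longrightarrow> \<not> C \<subset> C')"

definition cover ::
    "('a, 'm) ring_scheme \<Rightarrow> ('b, 'n) ring_scheme \<Rightarrow> ('a \<Rightarrow> 'b) \<Rightarrow> 'a set set \<Rightarrow> 'b set set \<Rightarrow> bool" where
  "cover S R f D C \<longleftrightarrow> D_chain S R f D C \<and> contraction S f ` C = D"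

definition perfect_cover ::
    "('a, 'm) ring_scheme \<Rightarrow> ('b, 'n) ring_scheme \<Rightarrow> ('a \<Rightarrow> 'b) \<Rightarrow> 'a set set \<Rightarrow> 'b set set \<Rightarrow> bool" where
  "perfect_cover S R f D C \<longleftrightarrow> D_chain S R f D C \<and> bij_betw (contraction S f) C D"

definition maximal_cover ::
    "('a, 'm) ring_scheme \<Rightarrow> ('b, 'n) ring_scheme \<Rightarrow> ('a \<Rightarrow> 'b) \<Rightarrow> 'a set set \<Rightarrow> 'b set set \<Rightarrow> bool" where
  "maximal_cover S R f D C \<longleftrightarrow>
     cover S R f D C \<and> (\<forall>C'. cover S R f D C' \<longrightarrow> \<not> C \<subset> C')"

definition perfect_maximal_cover ::
    "('a, 'm) ring_scheme \<Rightarrow> ('b, 'n) ring_scheme \<Rightarrow> ('a \<Rightarrow> 'b) \<Rightarrow> 'a set set \<Rightarrow> 'b set set \<Rightarrow> bool" where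
  "perfect_maximal_cover S R f D C \<longleftrightarrow> maximal_cover S R f D C \<and> perfect_cover S R f D C"

text \<open>
  Finiteness is explicit because \<open>card\<close> of an infinite set is \<open>0\<close>.
\<close>

definition layer ::
    "nat \<Rightarrow> ('a, 'm) ring_scheme \<Rightarrow> ('b, 'n) ring_scheme \<Rightarrow> ('a \<Rightarrow> 'b) \<Rightarrow> bool" where
  "layer n S R f \<longleftrightarrow>
     (\<forall>D. subset.chain (Spec S) D \<and> finite D \<and> card D = n \<longrightarrow>
        (\<forall>C. maximal_D_chain S R f D C \<longrightarrow> finite C \<and> card C = n))"

end

theory Submission
  imports Defs "HOL-Algebra.Ring_Divisibility"
begin

text \<open>
  The layer properties for \<open>n \<le> 3\<close> yield (2) by extending a suitable D-chain with at most two
  members to a maximal one and counting. Conversely, INC makes contraction injective on every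
  D-chain, so it remains to see that a maximal D-chain \<open>C\<close> meets the fibre of every \<open>P \<in> D\<close>. If it
  misses that fibre, then \<open>P\<close> cuts \<open>C\<close> into a lower part \<open>L\<close> and an upper part \<open>U\<close>. The intersection of
  \<open>U\<close> is prime, but in a noncommutative ring the union of \<open>L\<close> need not be. Since \<open>f\<close> has central image, the
  products \<open>f(s) n\<close> with \<open>s \<notin> P\<close> and \<open>n \<notin> \<Inter>U\<close> form an m-system disjoint from \<open>\<Union>L\<close>, so there is a
  prime \<open>Q\<close> with \<open>\<Union>L \<subseteq> Q \<subseteq> \<Inter>U\<close> whose contraction lies in \<open>P\<close>. If the contractions of \<open>Q\<close> and
  \<open>\<Inter>U\<close> both differ from \<open>P\<close>, SGB provides a prime over \<open>P\<close> between them. When \<open>L\<close> or \<open>U\<close> is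
  empty, GD, GU or LO takes the place of SGB. Such a prime can be added to \<open>C\<close>, which is absurd.
\<close>

section \<open>Prime ideals and m-systems\<close>

lemma prime_idealD:
  assumes "prime_ideal R P"
  shows "ideal P R" "P \<noteq> carrier R" "P \<subseteq> carrier R"
  using assms additive_subgroup.a_subset ideal.axioms(1) unfolding prime_ideal_def by auto

lemma prime_ideal_cases:
  assumes "prime_ideal R P" "a \<in> carrier R" "b \<in> carrier R"
    and "\<And>r. r \<in> carrier R \<Longrightarrow> a \<otimes>\<^bsub>R\<^esub> r \<otimes>\<^bsub>R\<^esub> b \<in> P"
  shows "a \<in> P \<or> b \<in> P"
  using assms unfolding prime_ideal_def by blast

text \<open>Closure under negation comes for free: the ring has an identity, so
  \<open>\<ominus> x\<close> is the multiple \<open>(\<ominus> \<one>) \<otimes> x\<close>.\<close>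

lemma (in ring) idealI_add_mult:
  assumes "I \<subseteq> carrier R" "\<zero> \<in> I"
    and add: "\<And>x y. x \<in> I \<Longrightarrow> y \<in> I \<Longrightarrow> x \<oplus> y \<in> I"
    and l: "\<And>x r. x \<in> I \<Longrightarrow> r \<in> carrier R \<Longrightarrow> r \<otimes> x \<in> I"
    and r: "\<And>x r. x \<in> I \<Longrightarrow> r \<in> carrier R \<Longrightarrow> x \<otimes> r \<in> I"
  shows "ideal I R"
proof (rule idealI[OF ring_axioms])
  have "\<ominus> x \<in> I" if "x \<in> I" for x
  proof -
    have "\<ominus> x = (\<ominus> \<one>) \<otimes> x"
      using that assms(1) by (simp add: l_minus subsetD)
    then show ?thesis
      using l[OF that, of "\<ominus> \<one>"] by simp
  qed
  then show "subgroup I (add_monoid R)"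
    using assms by (intro add.subgroupI) auto
qed (use l r in auto)

text \<open>The noncommutative counterpart of a multiplicatively closed set: an ideal is prime
  exactly when its complement is an m-system, nonemptiness matching properness.\<close>

definition m_system :: "('a, 'm) ring_scheme \<Rightarrow> 'a set \<Rightarrow> bool" where
  "m_system R T \<longleftrightarrow> T \<subseteq> carrier R \<and> T \<noteq> {} \<and>
     (\<forall>s \<in> T. \<forall>t \<in> T. \<exists>r \<in> carrier R. s \<otimes>\<^bsub>R\<^esub> r \<otimes>\<^bsub>R\<^esub> t \<in> T)"

lemma m_system_complement:
  assumes "prime_ideal R P"
  shows "m_system R (carrier R - P)"
proof -
  have "\<exists>r \<in> carrier R. s \<otimes>\<^bsub>R\<^esub> r \<otimes>\<^bsub>R\<^esub> t \<in> carrier R - P"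
    if st: "s \<in> carrier R - P" "t \<in> carrier R - P" for s t
  proof -
    interpret ideal P R
      using assms by (rule prime_idealD)
    obtain r where "r \<in> carrier R" "s \<otimes>\<^bsub>R\<^esub> r \<otimes>\<^bsub>R\<^esub> t \<notin> P"
      using prime_ideal_cases[OF assms, of s t] st by blast
    then show ?thesis
      using st by auto
  qed
  then show ?thesis
    using prime_idealD[OF assms] unfolding m_system_def by blast
qed

lemma (in ring) m_system_one: "m_system R {\<one>}"
  unfolding m_system_def by auto

text \<open>This quotient and its right-hand twin serve the maximality argument below: they replace
  the product of the ideals generated by \<open>Q\<close> with \<open>a\<close> and by
  \<open>Q\<close> with \<open>b\<close>, so no generated ideals are needed.\<close>

lemma (in ring) ideal_left_quotient:
  assumes "ideal I R" "b \<in> carrier R"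
  shows "ideal {x \<in> carrier R. \<forall>r \<in> carrier R. x \<otimes> r \<otimes> b \<in> I} R"
proof -
  interpret I: ideal I R by fact
  show ?thesis
  proof (rule idealI_add_mult)
    fix x r assume x: "x \<in> {x \<in> carrier R. \<forall>r \<in> carrier R. x \<otimes> r \<otimes> b \<in> I}" and r: "r \<in> carrier R"
    have "r \<otimes> x \<otimes> s \<otimes> b \<in> I" if "s \<in> carrier R" for s
    proof -
      have "r \<otimes> (x \<otimes> s \<otimes> b) \<in> I"
        using x that by (intro I.I_l_closed[OF _ r]) simp
      then show ?thesis
        using x r that assms(2) by (simp add: m_assoc)
    qed
    then show "r \<otimes> x \<in> {x \<in> carrier R. \<forall>r \<in> carrier R. x \<otimes> r \<otimes> b \<in> I}"
      using x r by simp
    have "x \<otimes> r \<otimes> s \<otimes> b \<in> I" if "s \<in> carrier R" for s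
    proof -
      have "x \<otimes> (r \<otimes> s) \<otimes> b \<in> I"
        using x r that by simp
      then show ?thesis
        using x r that assms(2) by (simp add: m_assoc)
    qed
    then show "x \<otimes> r \<in> {x \<in> carrier R. \<forall>r \<in> carrier R. x \<otimes> r \<otimes> b \<in> I}"
      using x r by simp
  qed (use assms(2) in \<open>auto simp: l_distr\<close>)
qed

lemma (in ring) ideal_right_quotient:
  assumes "ideal I R" "a \<in> carrier R"
  shows "ideal {y \<in> carrier R. \<forall>r \<in> carrier R. a \<otimes> r \<otimes> y \<in> I} R"
proof -
  interpret I: ideal I R by fact
  show ?thesis
  proof (rule idealI_add_mult)
    fix y r assume y: "y \<in> {y \<in> carrier R. \<forall>r \<in> carrier R. a \<otimes> r \<otimes> y \<in> I}" and r: "r \<in> carrier R"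
    have "a \<otimes> s \<otimes> (r \<otimes> y) \<in> I" if "s \<in> carrier R" for s
    proof -
      have "a \<otimes> (s \<otimes> r) \<otimes> y \<in> I"
        using y r that by simp
      then show ?thesis
        using y r that assms(2) by (simp add: m_assoc)
    qed
    then show "r \<otimes> y \<in> {y \<in> carrier R. \<forall>r \<in> carrier R. a \<otimes> r \<otimes> y \<in> I}"
      using y r by simp
    have "a \<otimes> s \<otimes> (y \<otimes> r) \<in> I" if "s \<in> carrier R" for s
    proof -
      have "a \<otimes> s \<otimes> y \<otimes> r \<in> I"
        using y that by (intro I.I_r_closed[OF _ r]) simp
      then show ?thesis
        using y r that assms(2) by (simp add: m_assoc)
    qed
    then show "y \<otimes> r \<in> {y \<in> carrier R. \<forall>r \<in> carrier R. a \<otimes> r \<otimes> y \<in> I}"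
      using y r by simp
  qed (use assms(2) in \<open>auto simp: r_distr\<close>)
qed

text \<open>Zorn yields an ideal \<open>Q\<close> maximal among those containing \<open>I\<close>
  and disjoint from \<open>T\<close>. Suppose \<open>a R b \<subseteq> Q\<close> with
  \<open>a\<close> and \<open>b\<close> outside \<open>Q\<close>. The left quotient by
  \<open>b\<close> properly contains \<open>Q\<close>, hence meets \<open>T\<close> in some
  \<open>s\<close>; then the right quotient by \<open>s\<close> properly contains \<open>Q\<close>,
  hence meets \<open>T\<close> in some \<open>t\<close>. Now \<open>s R t \<subseteq> Q\<close>
  contradicts the m-system property.\<close>

lemma (in ring) prime_ideal_avoiding_m_system:
  assumes "ideal I R" "m_system R T" "I \<inter> T = {}"
  shows "\<exists>Q. prime_ideal R Q \<and> I \<subseteq> Q \<and> Q \<inter> T = {}"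
proof -
  define \<A> where "\<A> = {J. ideal J R \<and> I \<subseteq> J \<and> J \<inter> T = {}}"
  have "\<exists>Q \<in> \<A>. \<forall>J \<in> \<A>. Q \<subseteq> J \<longrightarrow> J = Q"
  proof (rule subset_Zorn_nonempty)
    show "\<A> \<noteq> {}"
      using assms unfolding \<A>_def by auto
    fix \<C> assume "\<C> \<noteq> {}" and chain: "subset.chain \<A> \<C>"
    then have "\<C> \<subseteq> \<A>"
      unfolding subset_chain_def by simp
    moreover have "subset.chain {J. ideal J R} \<C>"
      using chain unfolding subset_chain_def \<A>_def by auto
    then have "ideal (\<Union>\<C>) R"
      using chain_Union_is_ideal[of \<C>] \<open>\<C> \<noteq> {}\<close> by simp
    ultimately show "\<Union>\<C> \<in> \<A>"
      using \<open>\<C> \<noteq> {}\<close> unfolding \<A>_def by blast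
  qed
  then obtain Q where Q: "Q \<in> \<A>" and max: "\<And>J. J \<in> \<A> \<Longrightarrow> Q \<subseteq> J \<Longrightarrow> J = Q"
    by blast
  interpret Q: ideal Q R
    using Q unfolding \<A>_def by simp
  have meets: "J \<inter> T \<noteq> {}" if "ideal J R" "Q \<subset> J" for J
    using max[of J] Q that unfolding \<A>_def by blast
  have "a \<in> Q \<or> b \<in> Q"
    if a: "a \<in> carrier R" and b: "b \<in> carrier R" and ab: "\<forall>r \<in> carrier R. a \<otimes> r \<otimes> b \<in> Q" for a b
  proof (rule ccontr)
    assume notin: "\<not> (a \<in> Q \<or> b \<in> Q)"
    let ?J = "{x \<in> carrier R. \<forall>r \<in> carrier R. x \<otimes> r \<otimes> b \<in> Q}"
    have "Q \<subseteq> ?J"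
      using Q.I_r_closed b by auto
    moreover have "a \<in> ?J"
      using a ab by simp
    ultimately have "?J \<inter> T \<noteq> {}"
      using notin by (intro meets ideal_left_quotient[OF Q.is_ideal b]) auto
    then obtain s where s: "s \<in> T" "s \<in> carrier R" "\<forall>r \<in> carrier R. s \<otimes> r \<otimes> b \<in> Q"
      by blast
    let ?K = "{y \<in> carrier R. \<forall>r \<in> carrier R. s \<otimes> r \<otimes> y \<in> Q}"
    have "Q \<subseteq> ?K"
      using Q.I_l_closed s by auto
    moreover have "b \<in> ?K"
      using b s by simp
    ultimately have "?K \<inter> T \<noteq> {}"
      using notin by (intro meets ideal_right_quotient[OF Q.is_ideal s(2)]) auto
    then obtain t where t: "t \<in> T" "\<forall>r \<in> carrier R. s \<otimes> r \<otimes> t \<in> Q"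
      by blast
    obtain r where "r \<in> carrier R" "s \<otimes> r \<otimes> t \<in> T"
      using assms(2) s t unfolding m_system_def by blast
    then show False
      using t Q unfolding \<A>_def by blast
  qed
  moreover have "Q \<noteq> carrier R"
    using Q assms(2) unfolding \<A>_def m_system_def by auto
  ultimately have "prime_ideal R Q"
    using Q.is_ideal unfolding prime_ideal_def by blast
  then show ?thesis
    using Q unfolding \<A>_def by blast
qed

text \<open>If one member of the chain omits \<open>a\<close> and another omits \<open>b\<close>,
  the smaller of the two omits both, against its primeness.\<close>

lemma (in ring) prime_ideal_Inter_chain:
  assumes "subset.chain (Spec R) C" "C \<noteq> {}"
  shows "prime_ideal R (\<Inter>C)"
proof -
  have prime: "prime_ideal R Q" if "Q \<in> C" for Q
    using assms that unfolding subset_chain_def Spec_def by blast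
  have "ideal (\<Inter>C) R"
    using assms(2) prime prime_idealD(1) by (intro i_Intersect) auto
  moreover have "\<Inter>C \<noteq> carrier R"
    using prime_idealD[OF prime] assms(2) by blast
  moreover have "a \<in> \<Inter>C \<or> b \<in> \<Inter>C"
    if a: "a \<in> carrier R" and b: "b \<in> carrier R" and ab: "\<forall>r \<in> carrier R. a \<otimes> r \<otimes> b \<in> \<Inter>C" for a b
  proof (rule ccontr)
    assume "\<not> (a \<in> \<Inter>C \<or> b \<in> \<Inter>C)"
    then obtain Q Q' where Q: "Q \<in> C" "Q' \<in> C" "a \<notin> Q" "b \<notin> Q'"
      by blast
    have "a \<in> Q'' \<or> b \<in> Q''" if "Q'' \<in> C" for Q''
      using prime_ideal_cases[OF prime[OF that] a b] ab that by blast
    then show False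
      using Q assms(1) unfolding subset_chain_def by blast
  qed
  ultimately show ?thesis
    unfolding prime_ideal_def by blast
qed

section \<open>Homomorphisms with central image\<close>

locale central_ring_hom = S: ring S + R: ring R
  for S :: "('a, 'm) ring_scheme" and R :: "('b, 'n) ring_scheme" +
  fixes f :: "'a \<Rightarrow> 'b"
  assumes hom: "f \<in> nonunital_ring_hom S R"
    and central: "f ` carrier S \<subseteq> ring_center R"
begin

lemma f_closed [simp]: "x \<in> carrier S \<Longrightarrow> f x \<in> carrier R"
  using hom unfolding nonunital_ring_hom_def hom_def by auto

lemma f_mult: "x \<in> carrier S \<Longrightarrow> y \<in> carrier S \<Longrightarrow> f (x \<otimes>\<^bsub>S\<^esub> y) = f x \<otimes>\<^bsub>R\<^esub> f y"
  using hom unfolding nonunital_ring_hom_def hom_def by auto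

lemma f_add: "x \<in> carrier S \<Longrightarrow> y \<in> carrier S \<Longrightarrow> f (x \<oplus>\<^bsub>S\<^esub> y) = f x \<oplus>\<^bsub>R\<^esub> f y"
  using hom unfolding nonunital_ring_hom_def hom_def by auto

lemma f_zero: "f \<zero>\<^bsub>S\<^esub> = \<zero>\<^bsub>R\<^esub>"
  using f_add[of "\<zero>\<^bsub>S\<^esub>" "\<zero>\<^bsub>S\<^esub>"] R.add.l_cancel_one[of "f \<zero>\<^bsub>S\<^esub>" "f \<zero>\<^bsub>S\<^esub>"] by simp

lemma f_commute: "x \<in> carrier S \<Longrightarrow> r \<in> carrier R \<Longrightarrow> f x \<otimes>\<^bsub>R\<^esub> r = r \<otimes>\<^bsub>R\<^esub> f x"
  using central unfolding ring_center_def by auto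

lemma f_left_commute:
  assumes "x \<in> carrier S" "r \<in> carrier R" "r' \<in> carrier R"
  shows "r \<otimes>\<^bsub>R\<^esub> (f x \<otimes>\<^bsub>R\<^esub> r') = f x \<otimes>\<^bsub>R\<^esub> (r \<otimes>\<^bsub>R\<^esub> r')"
  using assms f_commute[of x r] R.m_assoc[of r "f x" r'] R.m_assoc[of "f x" r r'] by simp

lemma contraction_mono: "Q \<subseteq> Q' \<Longrightarrow> contraction S f Q \<subseteq> contraction S f Q'"
  unfolding contraction_def by auto

lemma contraction_subset: "contraction S f Q \<subseteq> carrier S"
  unfolding contraction_def by auto

text \<open>By centrality \<open>f a r f b\<close> equals \<open>r f(ab)\<close>, so
  \<open>ab\<close> in the contraction already forces \<open>f a R f b\<close> into
  \<open>Q\<close>. Properness has to be assumed: \<open>f\<close> need not preserve the identity,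
  and \<open>Q\<close> may contain the whole image.\<close>

lemma contraction_prime:
  assumes "prime_ideal R Q" "contraction S f Q \<noteq> carrier S"
  shows "prime_ideal S (contraction S f Q)"
proof -
  interpret Q: ideal Q R
    using assms(1) by (rule prime_idealD)
  have "ideal (contraction S f Q) S"
    by (rule S.idealI_add_mult)
      (auto simp: contraction_def f_add f_mult f_zero Q.I_l_closed Q.I_r_closed)
  moreover have "a \<in> contraction S f Q \<or> b \<in> contraction S f Q"
    if a: "a \<in> carrier S" and b: "b \<in> carrier S"
      and ab: "\<forall>s \<in> carrier S. a \<otimes>\<^bsub>S\<^esub> s \<otimes>\<^bsub>S\<^esub> b \<in> contraction S f Q" for a b
  proof -
    have "f (a \<otimes>\<^bsub>S\<^esub> b) \<in> Q"
      using ab[rule_format, of "\<one>\<^bsub>S\<^esub>"] a unfolding contraction_def by simp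
    then have "f a \<otimes>\<^bsub>R\<^esub> r \<otimes>\<^bsub>R\<^esub> f b \<in> Q" if "r \<in> carrier R" for r
      using that a b Q.I_l_closed[of "f (a \<otimes>\<^bsub>S\<^esub> b)" r]
      by (simp add: f_mult f_commute[of a r] R.m_assoc)
    then have "f a \<in> Q \<or> f b \<in> Q"
      using prime_ideal_cases[OF assms(1)] a b by simp
    then show ?thesis
      using a b unfolding contraction_def by simp
  qed
  ultimately show ?thesis
    using assms(2) unfolding prime_ideal_def by blast
qed

lemma contraction_Spec:
  assumes "Q \<in> Spec R" "contraction S f Q \<subseteq> P" "P \<in> Spec S"
  shows "contraction S f Q \<in> Spec S"
  using assms contraction_prime[of Q] prime_idealD(2,3)[of S P] contraction_subset[of Q]
  unfolding Spec_def by blast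

text \<open>Central factors can be moved to the front. If \<open>t\<close> links \<open>s\<close> to
  \<open>s'\<close> in \<open>M\<close> and \<open>r\<close> links \<open>n\<close> to
  \<open>n'\<close> in \<open>N\<close>, then \<open>f t \<otimes> r\<close> links the two
  products.\<close>

lemma m_system_central_product:
  assumes "m_system S M" "m_system R N"
  shows "m_system R {f s \<otimes>\<^bsub>R\<^esub> n | s n. s \<in> M \<and> n \<in> N}" (is "m_system R ?T")
proof -
  have carr: "M \<subseteq> carrier S" "N \<subseteq> carrier R"
    using assms unfolding m_system_def by auto
  have "\<exists>r \<in> carrier R. x \<otimes>\<^bsub>R\<^esub> r \<otimes>\<^bsub>R\<^esub> y \<in> ?T" if xy: "x \<in> ?T" "y \<in> ?T" for x y
  proof -
    obtain s n s' n' where x: "x = f s \<otimes>\<^bsub>R\<^esub> n" "s \<in> M" "n \<in> N"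
      and y: "y = f s' \<otimes>\<^bsub>R\<^esub> n'" "s' \<in> M" "n' \<in> N"
      using xy by blast
    obtain t where t: "t \<in> carrier S" "s \<otimes>\<^bsub>S\<^esub> t \<otimes>\<^bsub>S\<^esub> s' \<in> M"
      using assms(1) x y unfolding m_system_def by blast
    obtain r where r: "r \<in> carrier R" "n \<otimes>\<^bsub>R\<^esub> r \<otimes>\<^bsub>R\<^esub> n' \<in> N"
      using assms(2) x y unfolding m_system_def by blast
    have c: "s \<in> carrier S" "s' \<in> carrier S" "n \<in> carrier R" "n' \<in> carrier R"
      using carr x y by auto
    have "x \<otimes>\<^bsub>R\<^esub> (f t \<otimes>\<^bsub>R\<^esub> r) \<otimes>\<^bsub>R\<^esub> y
        = f (s \<otimes>\<^bsub>S\<^esub> t \<otimes>\<^bsub>S\<^esub> s') \<otimes>\<^bsub>R\<^esub> (n \<otimes>\<^bsub>R\<^esub> r \<otimes>\<^bsub>R\<^esub> n')"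
      using c t r x y
      by (simp add: R.m_assoc f_mult f_left_commute[of t n] f_left_commute[of s' r]
          f_left_commute[of s' n])
    then show ?thesis
      using t r by (intro bexI[of _ "f t \<otimes>\<^bsub>R\<^esub> r"]) auto
  qed
  moreover have "?T \<subseteq> carrier R" "?T \<noteq> {}"
    using assms carr unfolding m_system_def by (auto simp: subset_iff)
  ultimately show ?thesis
    unfolding m_system_def by blast
qed

text \<open>No product \<open>f s n\<close> lies in a member \<open>Q\<close> of \<open>L\<close>:
  by centrality all of \<open>f s R n\<close> would lie in \<open>Q\<close>, hence
  \<open>f s\<close> or \<open>n\<close> would, against the bounds on \<open>L\<close>. The m-system
  \<open>N\<close> is a parameter because it controls how large the new prime may be.\<close>

lemma prime_above_chain:
  assumes L: "subset.chain (Spec R) L" "L \<noteq> {}" "\<forall>Q \<in> L. contraction S f Q \<subseteq> P"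
    and P: "P \<in> Spec S"
    and N: "m_system R N" "\<forall>Q \<in> L. Q \<inter> N = {}"
  shows "\<exists>Q \<in> Spec R. \<Union>L \<subseteq> Q \<and> Q \<inter> N = {} \<and> contraction S f Q \<subseteq> P"
proof -
  let ?T = "{f s \<otimes>\<^bsub>R\<^esub> n | s n. s \<in> carrier S - P \<and> n \<in> N}"
  have mM: "m_system S (carrier S - P)"
    using P m_system_complement unfolding Spec_def by auto
  have prime: "prime_ideal R Q" if "Q \<in> L" for Q
    using that L unfolding subset_chain_def Spec_def by blast
  have N_carr: "N \<subseteq> carrier R" "N \<noteq> {}"
    using N unfolding m_system_def by auto
  have "subset.chain {I. ideal I R} L"
    using L(1) prime_idealD(1)[OF prime] unfolding subset_chain_def by auto
  then have "ideal (\<Union>L) R"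
    using R.chain_Union_is_ideal[of L] L(2) by simp
  moreover have "f s \<otimes>\<^bsub>R\<^esub> n \<notin> Q"
    if Q: "Q \<in> L" and s: "s \<in> carrier S" "s \<notin> P" and n: "n \<in> N" for Q s n
  proof
    assume mem: "f s \<otimes>\<^bsub>R\<^esub> n \<in> Q"
    interpret Q: ideal Q R
      using prime[OF Q] by (rule prime_idealD)
    have "f s \<otimes>\<^bsub>R\<^esub> r \<otimes>\<^bsub>R\<^esub> n \<in> Q" if "r \<in> carrier R" for r
      using that s n N_carr mem Q.I_l_closed[OF mem that]
      by (simp add: f_commute[of s r] R.m_assoc subsetD)
    then have "f s \<in> Q \<or> n \<in> Q"
      using prime_ideal_cases[OF prime[OF Q], of "f s" n] s n N_carr by auto
    then show False
      using Q s n N(2) L(3) unfolding contraction_def by blast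
  qed
  then have "\<Union>L \<inter> ?T = {}"
    by blast
  ultimately obtain Q where Q: "prime_ideal R Q" "\<Union>L \<subseteq> Q" "Q \<inter> ?T = {}"
    using R.prime_ideal_avoiding_m_system[OF _ m_system_central_product[OF mM N(1)]] by blast
  interpret Q: ideal Q R
    using Q(1) by (rule prime_idealD)
  \<comment> \<open>Avoiding the products is enough to avoid both kinds of factor: an ideal that
    contains \<open>n\<close> or \<open>f s\<close> absorbs \<open>f s n\<close>.\<close>
  have disj: "f s \<otimes>\<^bsub>R\<^esub> n \<notin> Q" if "s \<in> carrier S - P" "n \<in> N" for s n
    using Q(3) that by blast
  obtain s where s: "s \<in> carrier S - P"
    using mM unfolding m_system_def by blast
  then have "Q \<inter> N = {}"
    using disj[OF s] Q.I_l_closed[of _ "f s"] by auto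
  moreover have "contraction S f Q \<subseteq> P"
    using disj N_carr Q.I_r_closed unfolding contraction_def by blast
  ultimately show ?thesis
    using Q unfolding Spec_def by blast
qed

section \<open>Maximal D-chains\<close>

lemma D_chain_insert:
  "D_chain S R f D (insert Q C) \<longleftrightarrow>
     Q \<in> Spec R \<and> contraction S f Q \<in> D \<and> (\<forall>Q' \<in> C. Q' \<subseteq> Q \<or> Q \<subseteq> Q') \<and> D_chain S R f D C"
  unfolding D_chain_def subset_chain_insert by auto

lemma D_chainD:
  assumes "D_chain S R f D C"
  shows "subset.chain (Spec R) C" "contraction S f ` C \<subseteq> D"
    and "Q \<in> C \<Longrightarrow> Q \<in> Spec R" "Q \<in> C \<Longrightarrow> contraction S f Q \<in> D"
    and "Q \<in> C \<Longrightarrow> Q' \<in> C \<Longrightarrow> Q \<subseteq> Q' \<or> Q' \<subseteq> Q"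
  using assms unfolding D_chain_def subset_chain_def by auto

lemma maximal_D_chain_imp_D_chain:
  "maximal_D_chain S R f D C \<Longrightarrow> D_chain S R f D C"
  unfolding maximal_D_chain_def by simp

lemma D_chain_subset:
  "D_chain S R f D C \<Longrightarrow> C' \<subseteq> C \<Longrightarrow> D_chain S R f D C'"
  unfolding D_chain_def subset_chain_def subset_iff by simp

lemma D_chain_empty: "D_chain S R f D {}"
  unfolding D_chain_def subset_chain_def by simp

lemma maximal_D_chain_insert:
  assumes "maximal_D_chain S R f D C" "Q \<in> Spec R" "contraction S f Q \<in> D"
    and "\<forall>Q' \<in> C. Q' \<subseteq> Q \<or> Q \<subseteq> Q'"
  shows "Q \<in> C"
  using assms D_chain_insert[of D Q C] unfolding maximal_D_chain_def by blast

lemma maximal_D_chain_extends: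
  assumes "D_chain S R f D C0"
  shows "\<exists>C. maximal_D_chain S R f D C \<and> C0 \<subseteq> C"
proof -
  \<comment> \<open>Hausdorff's principle gives a maximal chain with no prescribed members.
    Restricting it to the primes comparable with all of \<open>C0\<close> makes every maximal chain
    contain \<open>C0\<close>, and every D-chain containing \<open>C0\<close> stays inside
    \<open>A\<close>.\<close>
  define A where
    "A = {Q \<in> Spec R. contraction S f Q \<in> D \<and> (\<forall>Q' \<in> C0. Q' \<subseteq> Q \<or> Q \<subseteq> Q')}"
  have A: "subset.chain A C \<longleftrightarrow> D_chain S R f D C \<and> C \<subseteq> A" for C
    unfolding A_def D_chain_def subset_chain_def by auto
  obtain C where "subset.maxchain A C"
    using subset.Hausdorff by blast
  then have C: "subset.chain A C" and max: "\<And>C'. subset.chain A C' \<Longrightarrow> \<not> C \<subset> C'"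
    unfolding subset.maxchain_def by auto
  have "C0 \<subseteq> A" "\<forall>X \<in> C0. \<forall>Y \<in> C0. X \<subseteq> Y \<or> Y \<subseteq> X"
    using assms unfolding A_def D_chain_def subset_chain_def by blast+
  moreover have "C \<subseteq> A" "\<forall>X \<in> C. \<forall>Y \<in> C. X \<subseteq> Y \<or> Y \<subseteq> X"
    using C unfolding subset_chain_def by blast+
  moreover from this have "\<forall>X \<in> C. \<forall>Y \<in> C0. X \<subseteq> Y \<or> Y \<subseteq> X"
    unfolding A_def by blast
  ultimately have "subset.chain A (C \<union> C0)"
    unfolding subset_chain_def ball_Un by (simp; blast)
  then have sub: "C0 \<subseteq> C"
    using max by blast
  moreover have "\<not> C \<subset> C'" if "D_chain S R f D C'" for C'
  proof
    assume "C \<subset> C'"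
    then have "C' \<subseteq> A"
      using D_chainD(3-5)[OF that] sub unfolding A_def by blast
    then have "subset.chain A C'"
      using that A by simp
    then show False
      using max \<open>C \<subset> C'\<close> by blast
  qed
  ultimately show ?thesis
    using C A unfolding maximal_D_chain_def by blast
qed

text \<open>Contractions of members of \<open>C\<close> belong to \<open>D\<close>, hence are
  proper, which is the side condition of INC.\<close>

lemma INC_inj_on:
  assumes "INC S R f" "subset.chain (Spec S) D" "D_chain S R f D C"
  shows "inj_on (contraction S f) C"
proof (rule inj_onI, rule ccontr)
  fix Q Q' assume Q: "Q \<in> C" "Q' \<in> C" "contraction S f Q = contraction S f Q'" "Q \<noteq> Q'"
  have "contraction S f Q \<noteq> carrier S"
    using Q assms(2,3) prime_idealD(2)[of S "contraction S f Q"]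
    unfolding D_chain_def subset_chain_def Spec_def by blast
  moreover have "Q \<subset> Q' \<or> Q' \<subset> Q" "Q \<in> Spec R" "Q' \<in> Spec R"
    using Q assms(3) unfolding D_chain_def subset_chain_def by blast+
  ultimately show False
    using assms(1) Q(3) unfolding INC_def by auto
qed

section \<open>From the layer properties to LO, INC, GD, GU and SGB\<close>

lemma layer_card:
  assumes "layer n S R f" "subset.chain (Spec S) D" "finite D" "card D = n"
    and "maximal_D_chain S R f D C"
  shows "card C = n"
  using assms unfolding layer_def by blast

lemma LO_of_layer_1:
  assumes "layer 1 S R f"
  shows "LO S R f"
  unfolding LO_def lies_over_def
proof
  fix P assume P: "P \<in> Spec S"
  then have D: "subset.chain (Spec S) {P}"
    unfolding subset_chain_def by simp
  obtain C where C: "maximal_D_chain S R f {P} C"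
    using maximal_D_chain_extends[OF D_chain_empty] by blast
  then have "card C = 1"
    using layer_card[OF assms D] C by simp
  then obtain Q where "Q \<in> C"
    by (metis card_1_singletonE insertI1)
  then show "\<exists>Q \<in> Spec R. contraction S f Q = P"
    using D_chainD(3,4)[OF maximal_D_chain_imp_D_chain[OF C]] by blast
qed

text \<open>Two comparable primes with the same proper contraction \<open>P\<close> would form a
  two-element \<open>{P}\<close>-chain, which extends to a maximal one with a single member.\<close>

lemma INC_of_layer_1:
  assumes "layer 1 S R f"
  shows "INC S R f"
  unfolding INC_def
proof (intro ballI impI, elim conjE)
  fix Q1 Q2 assume Q: "Q1 \<in> Spec R" "Q2 \<in> Spec R" "Q1 \<subset> Q2" "contraction S f Q2 \<noteq> carrier S"
  let ?P = "contraction S f Q2"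
  have D: "subset.chain (Spec S) {?P}"
    using Q contraction_prime[of Q2] unfolding subset_chain_def Spec_def by simp
  have "contraction S f Q1 \<noteq> ?P"
  proof
    assume "contraction S f Q1 = ?P"
    then have "D_chain S R f {?P} {Q1, Q2}"
      using Q by (auto simp: D_chain_insert D_chain_empty)
    then obtain C where C: "maximal_D_chain S R f {?P} C" "{Q1, Q2} \<subseteq> C"
      using maximal_D_chain_extends by blast
    then have "card C = 1"
      using layer_card[OF assms D] C by simp
    then show False
      using C(2) Q(3) by (metis card_1_singletonE insert_subset psubset_eq singletonD)
  qed
  then show "contraction S f Q1 \<subset> ?P"
    using contraction_mono Q(3) by blast
qed

text \<open>INC makes contraction injective on \<open>C\<close>, and an injection between finite
  sets of equal size is onto.\<close>

lemma layer_surj: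
  assumes "layer n S R f" "INC S R f"
    and D: "subset.chain (Spec S) D" "finite D" "card D = n"
    and C: "maximal_D_chain S R f D C"
  shows "contraction S f ` C = D"
proof (rule card_subset_eq[OF D(2)])
  have DC: "D_chain S R f D C"
    using C by (rule maximal_D_chain_imp_D_chain)
  then show "contraction S f ` C \<subseteq> D"
    by (rule D_chainD)
  have "card C = n"
    using layer_card[OF assms(1) D C] .
  then show "card (contraction S f ` C) = card D"
    using card_image[OF INC_inj_on[OF assms(2) D(1) DC]] D(3) by simp
qed

text \<open>Common source of GD, GU and SGB: \<open>C0\<close> holds the given primes of
  \<open>R\<close>, and the chain \<open>insert Q C0\<close> records that the new prime is
  comparable with them.\<close>

lemma layer_lift:
  assumes "layer n S R f" "INC S R f"
    and D: "subset.chain (Spec S) D" "finite D" "card D = n" "P \<in> D"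
    and C: "D_chain S R f D C0"
  shows "\<exists>Q \<in> Spec R. contraction S f Q = P \<and> D_chain S R f D (insert Q C0)"
proof -
  obtain C where C: "maximal_D_chain S R f D C" "C0 \<subseteq> C"
    using maximal_D_chain_extends[OF C] by blast
  obtain Q where "Q \<in> C" "contraction S f Q = P"
    using layer_surj[OF assms(1-5) C(1)] D(4) by blast
  moreover from this C(2) have "insert Q C0 \<subseteq> C"
    by simp
  then have "D_chain S R f D (insert Q C0)"
    using D_chain_subset[OF maximal_D_chain_imp_D_chain[OF C(1)]] by blast
  ultimately show ?thesis
    using D_chainD(3)[OF maximal_D_chain_imp_D_chain[OF C(1)]] by blast
qed

text \<open>The opposite inclusion would reverse the contractions, so their strict order decides
  which way comparable primes are nested.\<close>

lemma comparable_psubset: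
  assumes "Q \<subseteq> Q' \<or> Q' \<subseteq> Q" "contraction S f Q \<subset> contraction S f Q'"
  shows "Q \<subset> Q'"
  using assms contraction_mono[of Q' Q] by blast

lemma GD_of_layer_2:
  assumes "layer 2 S R f" "INC S R f"
  shows "GD S R f"
  unfolding GD_def lies_over_def
proof (intro ballI impI)
  fix P1 P2 Q2 assume P: "P1 \<in> Spec S" "P2 \<in> Spec S" "P1 \<subset> P2"
    and Q: "Q2 \<in> Spec R" "contraction S f Q2 = P2"
  have D: "subset.chain (Spec S) {P1, P2}" "card {P1, P2} = 2"
    using P by (auto simp: subset_chain_def)
  have "D_chain S R f {P1, P2} {Q2}"
    using Q by (simp add: D_chain_insert D_chain_empty)
  from layer_lift[OF assms D(1) _ D(2) _ this, of P1]
  obtain Q1 where "Q1 \<in> Spec R" "contraction S f Q1 = P1" "Q2 \<subseteq> Q1 \<or> Q1 \<subseteq> Q2"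
    by (auto simp: D_chain_insert)
  then show "\<exists>Q1 \<in> Spec R. Q1 \<subset> Q2 \<and> contraction S f Q1 = P1"
    using comparable_psubset[of Q1 Q2] P(3) Q(2) by blast
qed

lemma GU_of_layer_2:
  assumes "layer 2 S R f" "INC S R f"
  shows "GU S R f"
  unfolding GU_def lies_over_def
proof (intro ballI impI)
  fix P1 P2 Q1 assume P: "P1 \<in> Spec S" "P2 \<in> Spec S" "P1 \<subset> P2"
    and Q: "Q1 \<in> Spec R" "contraction S f Q1 = P1"
  have D: "subset.chain (Spec S) {P1, P2}" "card {P1, P2} = 2"
    using P by (auto simp: subset_chain_def)
  have "D_chain S R f {P1, P2} {Q1}"
    using Q by (simp add: D_chain_insert D_chain_empty)
  from layer_lift[OF assms D(1) _ D(2) _ this, of P2]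
  obtain Q2 where "Q2 \<in> Spec R" "contraction S f Q2 = P2" "Q1 \<subseteq> Q2 \<or> Q2 \<subseteq> Q1"
    by (auto simp: D_chain_insert)
  then show "\<exists>Q2 \<in> Spec R. Q1 \<subset> Q2 \<and> contraction S f Q2 = P2"
    using comparable_psubset[of Q1 Q2] P(3) Q(2) by blast
qed

lemma SGB_of_layer_3:
  assumes "layer 3 S R f" "INC S R f"
  shows "SGB S R f"
  unfolding SGB_def lies_over_def
proof (intro ballI impI, elim conjE)
  fix P1 P2 P3 Q1 Q3
  assume P: "P1 \<in> Spec S" "P2 \<in> Spec S" "P3 \<in> Spec S" "P1 \<subset> P2" "P2 \<subset> P3"
    and Q: "Q1 \<in> Spec R" "Q3 \<in> Spec R" "Q1 \<subset> Q3"
      "contraction S f Q1 = P1" "contraction S f Q3 = P3"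
  have "P1 \<noteq> P2" "P2 \<noteq> P3" "P1 \<noteq> P3"
    using P by auto
  then have D: "subset.chain (Spec S) {P1, P2, P3}" "card {P1, P2, P3} = 3"
    using P by (auto simp: subset_chain_def)
  have "D_chain S R f {P1, P2, P3} {Q1, Q3}"
    using Q by (auto simp: D_chain_insert D_chain_empty)
  from layer_lift[OF assms D(1) _ D(2) _ this, of P2]
  obtain Q2 where "Q2 \<in> Spec R" "contraction S f Q2 = P2"
    "Q1 \<subseteq> Q2 \<or> Q2 \<subseteq> Q1" "Q2 \<subseteq> Q3 \<or> Q3 \<subseteq> Q2"
    by (auto simp: D_chain_insert)
  then show "\<exists>Q2 \<in> Spec R. Q1 \<subset> Q2 \<and> Q2 \<subset> Q3 \<and> contraction S f Q2 = P2"
    using comparable_psubset[of Q1 Q2] comparable_psubset[of Q2 Q3] P(4,5) Q(4,5) by blast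
qed

section \<open>From LO, INC, GD, GU and SGB to perfect maximal covers\<close>

text \<open>\<open>L\<close> and \<open>U\<close> may be infinite, so they need not have a largest
  or smallest member to which a lifting property applies. The primes bounding them instead may
  themselves lie over \<open>P\<close>, and then they are the answer.\<close>

lemma prime_between_chains:
  assumes LO: "LO S R f" and GD: "GD S R f" and GU: "GU S R f" and SGB: "SGB S R f"
    and P: "P \<in> Spec S"
    and L: "subset.chain (Spec R) L" "\<forall>Q \<in> L. contraction S f Q \<subseteq> P"
    and U: "subset.chain (Spec R) U" "\<forall>Q \<in> U. P \<subseteq> contraction S f Q \<and> contraction S f Q \<in> Spec S"
    and LU: "\<forall>Q \<in> L. \<forall>Q' \<in> U. Q \<subseteq> Q'"
  shows "\<exists>Q \<in> Spec R. contraction S f Q = P \<and> (\<forall>Q' \<in> L. Q' \<subseteq> Q) \<and> (\<forall>Q' \<in> U. Q \<subseteq> Q')"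
proof -
  \<comment> \<open>The contraction of \<open>\<Inter>U\<close> lies inside that of any member of
    \<open>U\<close>, hence is proper and so prime.\<close>
  have upper: "\<Inter>U \<in> Spec R" "P \<subseteq> contraction S f (\<Inter>U)" "contraction S f (\<Inter>U) \<in> Spec S"
    if ne: "U \<noteq> {}"
  proof -
    show spec: "\<Inter>U \<in> Spec R"
      using R.prime_ideal_Inter_chain[OF U(1) that] unfolding Spec_def by simp
    show "P \<subseteq> contraction S f (\<Inter>U)"
      using U(2) that unfolding contraction_def by blast
    obtain Q where "Q \<in> U"
      using ne by blast
    then show "contraction S f (\<Inter>U) \<in> Spec S"
      using contraction_Spec[OF spec contraction_mono] U(2) by blast
  qed
  consider "L = {}" "U = {}" | "L = {}" "U \<noteq> {}" | "L \<noteq> {}" "U = {}" | "L \<noteq> {}" "U \<noteq> {}"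
    by blast
  then show ?thesis
  proof cases
    case 1
    then show ?thesis
      using LO P unfolding LO_def lies_over_def by simp
  next
    case 2
    show ?thesis
    proof (cases "contraction S f (\<Inter>U) = P")
      case True
      then show ?thesis
        using upper 2 by blast
    next
      case False
      then have "P \<subset> contraction S f (\<Inter>U)"
        using upper 2 by blast
      then obtain Q where "Q \<in> Spec R" "Q \<subset> \<Inter>U" "contraction S f Q = P"
        using GD[unfolded GD_def lies_over_def, rule_format, OF P upper(3)[OF 2(2)] _ upper(1)[OF 2(2)]]
        by blast
      then show ?thesis
        using 2 by blast
    qed
  next
    case 3
    \<comment> \<open>With nothing above, \<open>N\<close> is \<open>{\<one>}\<close>: being
      disjoint from it only says that an ideal is proper.\<close>
    have "Q \<inter> {\<one>\<^bsub>R\<^esub>} = {}" if "Q \<in> L" for Q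
    proof -
      have "prime_ideal R Q"
        using that L(1) unfolding subset_chain_def Spec_def by blast
      then show ?thesis
        using prime_idealD ideal.one_imp_carrier by blast
    qed
    then obtain Q where Q: "Q \<in> Spec R" "\<Union>L \<subseteq> Q" "contraction S f Q \<subseteq> P"
      using prime_above_chain[OF L(1) _ L(2) P R.m_system_one] 3 by blast
    show ?thesis
    proof (cases "contraction S f Q = P")
      case True
      then show ?thesis
        using Q 3 by blast
    next
      case False
      then have "contraction S f Q \<subset> P"
        using Q(3) by blast
      then obtain Q' where "Q' \<in> Spec R" "Q \<subset> Q'" "contraction S f Q' = P"
        using GU[unfolded GU_def lies_over_def, rule_format,
            OF contraction_Spec[OF Q(1,3) P] P _ Q(1)] by blast
      then show ?thesis
        using Q 3 by blast
    qed
  next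
    case 4
    \<comment> \<open>For this \<open>N\<close>, disjointness from \<open>N\<close> means
      containment in \<open>\<Inter>U\<close>.\<close>
    have N: "m_system R (carrier R - \<Inter>U)"
      using upper(1)[OF 4(2)] m_system_complement unfolding Spec_def by blast
    have disj: "\<forall>Q \<in> L. Q \<inter> (carrier R - \<Inter>U) = {}"
      using LU by blast
    obtain Q where Q: "Q \<in> Spec R" "\<Union>L \<subseteq> Q" "Q \<inter> (carrier R - \<Inter>U) = {}"
      "contraction S f Q \<subseteq> P"
      using prime_above_chain[OF L(1) 4(1) L(2) P N disj] by blast
    have QU: "Q \<subseteq> \<Inter>U"
      using Q(1,3) prime_idealD(3)[of R Q] unfolding Spec_def by blast
    consider "contraction S f Q = P" | "contraction S f (\<Inter>U) = P"
      | "contraction S f Q \<subset> P" "P \<subset> contraction S f (\<Inter>U)"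
      using Q(4) upper(2)[OF 4(2)] by blast
    then show ?thesis
    proof cases
      case 1
      then show ?thesis
        using Q QU by blast
    next
      case 2
      then show ?thesis
        using LU upper(1)[OF 4(2)] by blast
    next
      case 3
      then have "Q \<subset> \<Inter>U"
        using QU by blast
      then obtain Q' where "Q' \<in> Spec R" "Q \<subset> Q'" "Q' \<subset> \<Inter>U" "contraction S f Q' = P"
        using SGB[unfolded SGB_def lies_over_def, rule_format,
            OF contraction_Spec[OF Q(1,4) P] P upper(3)[OF 4(2)] _ Q(1) upper(1)[OF 4(2)]] 3
        by blast
      then show ?thesis
        using Q(2) by blast
    qed
  qed
qed

lemma maximal_D_chain_surj:
  assumes "LO S R f" "GD S R f" "GU S R f" "SGB S R f"
    and D: "subset.chain (Spec S) D" and C: "maximal_D_chain S R f D C"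
  shows "contraction S f ` C = D"
proof
  note DC = D_chainD[OF maximal_D_chain_imp_D_chain[OF C]]
  show "contraction S f ` C \<subseteq> D"
    by (rule DC)
  show "D \<subseteq> contraction S f ` C"
  proof (rule subsetI, rule ccontr)
    fix P assume P: "P \<in> D" "P \<notin> contraction S f ` C"
    define L where "L = {Q \<in> C. contraction S f Q \<subset> P}"
    define U where "U = {Q \<in> C. P \<subset> contraction S f Q}"
    \<comment> \<open>\<open>P\<close> is comparable with every contraction, both being in the chain
      \<open>D\<close>, and equals none of them.\<close>
    have split: "C = L \<union> U"
    proof -
      have "contraction S f Q \<subset> P \<or> P \<subset> contraction S f Q" if "Q \<in> C" for Q
        using P D DC(4)[OF that] that unfolding subset_chain_def by blast
      then show ?thesis
        unfolding L_def U_def by blast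
    qed
    have chains: "subset.chain (Spec R) L" "subset.chain (Spec R) U"
      using DC(1) unfolding subset_chain_def L_def U_def subset_iff by simp_all
    have LU: "\<forall>Q \<in> L. \<forall>Q' \<in> U. Q \<subseteq> Q'"
    proof (intro ballI)
      fix Q Q' assume "Q \<in> L" "Q' \<in> U"
      then have "Q \<subseteq> Q' \<or> Q' \<subseteq> Q" "contraction S f Q \<subset> contraction S f Q'"
        using DC(5)[of Q Q'] unfolding L_def U_def by blast+
      then show "Q \<subseteq> Q'"
        using comparable_psubset by blast
    qed
    have spec: "D \<subseteq> Spec S"
      using D unfolding subset_chain_def by simp
    then have "\<forall>Q \<in> U. P \<subseteq> contraction S f Q \<and> contraction S f Q \<in> Spec S"
      using DC(4) unfolding U_def by blast
    moreover have "P \<in> Spec S" "\<forall>Q \<in> L. contraction S f Q \<subseteq> P"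
      using spec P(1) unfolding L_def by blast+
    ultimately obtain Q where Q: "Q \<in> Spec R" "contraction S f Q = P"
      "\<forall>Q' \<in> L. Q' \<subseteq> Q" "\<forall>Q' \<in> U. Q \<subseteq> Q'"
      using prime_between_chains[OF assms(1-4) _ chains(1) _ chains(2) _ LU, of P] by blast
    have "Q \<in> C"
      using maximal_D_chain_insert[OF C Q(1)] Q P(1) split by blast
    then show False
      using P(2) Q(2) by blast
  qed
qed

text \<open>Every cover is a D-chain, so once \<open>C\<close> is known to be a cover, its
  maximality among D-chains gives maximality among covers.\<close>

lemma maximal_D_chain_perfect:
  assumes "LO S R f" "INC S R f" "GD S R f" "GU S R f" "SGB S R f"
    and D: "subset.chain (Spec S) D" and C: "maximal_D_chain S R f D C"
  shows "perfect_maximal_cover S R f D C"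
proof -
  have surj: "contraction S f ` C = D"
    using maximal_D_chain_surj[OF assms(1,3-7)] .
  have DC: "D_chain S R f D C"
    using C by (rule maximal_D_chain_imp_D_chain)
  show ?thesis
    using surj DC C INC_inj_on[OF assms(2) D DC]
    unfolding perfect_maximal_cover_def maximal_cover_def perfect_cover_def cover_def
      maximal_D_chain_def bij_betw_def by blast
qed

end

theorem corollary2p14:
  fixes S :: "('a, 'm) ring_scheme" and R :: "('b, 'n) ring_scheme" and f :: "'a \<Rightarrow> 'b"
  assumes "nontrivial_ring S" and "nontrivial_ring R"
    and "f \<in> nonunital_ring_hom S R"
    and "f ` carrier S \<subseteq> ring_center R"
  shows "((layer 1 S R f \<and> layer 2 S R f \<and> layer 3 S R f) \<longleftrightarrow>
            (LO S R f \<and> INC S R f \<and> GD S R f \<and> GU S R f \<and> SGB S R f)) \<and>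
         ((LO S R f \<and> INC S R f \<and> GD S R f \<and> GU S R f \<and> SGB S R f) \<longleftrightarrow>
            (\<forall>D. subset.chain (Spec S) D \<longrightarrow>
              (\<forall>C. maximal_D_chain S R f D C \<longrightarrow> perfect_maximal_cover S R f D C))) \<and>
         ((\<forall>D. subset.chain (Spec S) D \<longrightarrow>
              (\<forall>C. maximal_D_chain S R f D C \<longrightarrow> perfect_maximal_cover S R f D C)) \<longleftrightarrow>
            (\<forall>D. subset.chain (Spec S) D \<longrightarrow>
              (\<forall>C. maximal_D_chain S R f D C \<longrightarrow> C \<approx> D)))"
proof -
  interpret central_ring_hom S R f
    using assms unfolding nontrivial_ring_def central_ring_hom_def central_ring_hom_axioms_def
    by simp
  let ?lift = "LO S R f \<and> INC S R f \<and> GD S R f \<and> GU S R f \<and> SGB S R f"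
  let ?perfect = "\<forall>D. subset.chain (Spec S) D \<longrightarrow>
    (\<forall>C. maximal_D_chain S R f D C \<longrightarrow> perfect_maximal_cover S R f D C)"
  let ?eqpoll = "\<forall>D. subset.chain (Spec S) D \<longrightarrow>
    (\<forall>C. maximal_D_chain S R f D C \<longrightarrow> C \<approx> D)"
  have "?lift" if "layer 1 S R f" "layer 2 S R f" "layer 3 S R f"
    using that LO_of_layer_1 INC_of_layer_1 GD_of_layer_2 GU_of_layer_2 SGB_of_layer_3 by blast
  moreover have "?perfect" if "?lift"
    using that maximal_D_chain_perfect by blast
  moreover have "?eqpoll" if "?perfect"
    using that unfolding perfect_maximal_cover_def perfect_cover_def eqpoll_def by blast
  \<comment> \<open>This closes the cycle of implications, for every \<open>n\<close> at once: a set
    equipollent to a finite one is finite of the same cardinality.\<close>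
  moreover have "layer n S R f" if "?eqpoll" for n
    unfolding layer_def
  proof (intro allI impI, elim conjE)
    fix D C
    assume D: "subset.chain (Spec S) D" "finite D" "card D = n" and "maximal_D_chain S R f D C"
    then have "C \<approx> D"
      using that by blast
    then show "finite C \<and> card C = n"
      using D eqpoll_finite_iff eqpoll_iff_card by blast
  qed
  ultimately show ?thesis
    by metis
qed

end
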